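(* Let $L=\{1,2,4\}$. For all integers $m\ge 0$, $t\ge 0$ and $\ell_1,\ldots,\ell_t\ge 0$, we have $\mathcal{G}_L(S_{\ell_1,\ldots,\ell_t,m+3})=\mathcal{G}_L(S_{\ell_1,\ldots,\ell_t,m})$.
   Context: For a set $L$ of positive integers, the game $CSG(L)$ on a connected graph $G$ is the two-player impartial game in which a move consists in removing from the current graph a connected subgraph $H$ such that $|V(H)|\in L$ and the remaining graph is connected (the empty graph counts as connected, so removing the whole graph is allowed when its size is in $L$). The player unable to move loses. $\mathcal{G}_L(G)$ is the Grundy value of $CSG(L)$ on $G$. The subdivided star $S_{\ell_1,\ldots,\ell_t}$ is obtained from a central vertex by attaching $t$ disjoint paths with $\ell_1,\ldots,\ell_t$ vertices respectively (an endpoint of each path adjacent to the center; paths with $0$ vertices allowed). *)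

theory Defs
  imports "Graph_Theory.Graph_Theory"
begin

text \<open>
  Finite simple graphs are the symmetric, loop-free, finite digraphs without parallel arcs of
  Graph_Theory (locale \<^locale>\<open>graph\<close>). There \<^const>\<open>connected\<close> excludes the empty graph,
  which the game allows as a final position; hence the explicit disjunct below.
  Since \<open>H\<close> is connected it is nonempty, so every move decreases the number of vertices.
\<close>

definition csg_move ::
  "nat set \<Rightarrow> ('a, 'b) pre_digraph \<Rightarrow> ('a, 'b) pre_digraph \<Rightarrow> bool" where
  "csg_move L G G' \<longleftrightarrow> graph G \<and>
     (\<exists>H. graph H \<and> subgraph H G \<and> connected H \<and> card (verts H) \<in> L \<and>
          G' = G \<restriction> (verts G - verts H) \<and> (verts G' = {} \<or> connected G'))"

lemma csg_move_card_less:
  assumes "csg_move L G G'"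
  shows "card (verts G') < card (verts G)"
proof -
  from assms obtain H where G: "graph G" and H: "subgraph H G" "connected H"
    and G': "G' = G \<restriction> (verts G - verts H)"
    by (auto simp: csg_move_def)
  interpret graph G by (rule G)
  have "verts H \<subseteq> verts G" "verts H \<noteq> {}"
    using H by (auto simp: subgraph_def connected_def strongly_connected_def mk_symmetric_def)
  then have "verts G' \<subset> verts G" using G' by auto
  then show ?thesis by (simp add: psubset_card_mono)
qed

lemma finite_csg_moves: "finite {G'. csg_move L G G'}"
proof (cases "graph G")
  case True
  then interpret graph G .
  have "{G'. csg_move L G G'} \<subseteq> (\<lambda>S. G \<restriction> S) ` Pow (verts G)"
    by (auto simp: csg_move_def)
  then show ?thesis by (rule finite_subset) simp
qed (simp add: csg_move_def)

definition mex :: "nat set \<Rightarrow> nat" where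
  "mex A = (LEAST n. n \<notin> A)"

function grundy :: "nat set \<Rightarrow> ('a, 'b) pre_digraph \<Rightarrow> nat" where
  "grundy L G = mex (grundy L ` {G'. csg_move L G G'})"
  by auto
termination
  by (relation "measure (\<lambda>(L, G). card (verts G))") (auto simp: csg_move_card_less)

declare grundy.simps [simp del]

text \<open>
  In the subdivided star, \<^term>\<open>None\<close> is the center and \<^term>\<open>Some (i, j)\<close> is the vertex of the
  \<open>i\<close>-th path at distance \<open>j + 1\<close> from the center.
\<close>

definition star_verts :: "nat list \<Rightarrow> (nat \<times> nat) option set" where
  "star_verts ls = insert None {Some (i, j) | i j. i < length ls \<and> j < ls ! i}"

definition star_edges :: "nat list \<Rightarrow> (nat \<times> nat) option rel" where
  "star_edges ls =
     {(None, Some (i, 0)) | i. i < length ls \<and> 0 < ls ! i} \<union>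
     {(Some (i, j), Some (i, Suc j)) | i j. i < length ls \<and> Suc j < ls ! i}"

definition subdivided_star ::
  "nat list \<Rightarrow> ((nat \<times> nat) option, (nat \<times> nat) option \<times> (nat \<times> nat) option) pre_digraph" where
  "subdivided_star ls =
     with_proj \<lparr> pverts = star_verts ls, parcs = star_edges ls \<union> (star_edges ls)\<inverse> \<rparr>"

lemma finite_star_verts: "finite (star_verts ls)"
proof -
  have "star_verts ls = insert None (Some ` (SIGMA i:{..<length ls}. {..<ls ! i}))"
    by (auto simp: star_verts_def)
  then show ?thesis by simp
qed

lemma graph_subdivided_star: "graph (subdivided_star ls)"
proof -
  have sub: "star_edges ls \<union> (star_edges ls)\<inverse> \<subseteq> star_verts ls \<times> star_verts ls"
    by (auto simp: star_edges_def star_verts_def)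
  then have fin: "finite (star_edges ls \<union> (star_edges ls)\<inverse>)"
    by (rule finite_subset) (simp add: finite_star_verts)
  have sym: "sym (star_edges ls \<union> (star_edges ls)\<inverse>)"
    by (rule sym_Un_converse)
  have "pair_graph \<lparr> pverts = star_verts ls, parcs = star_edges ls \<union> (star_edges ls)\<inverse> \<rparr>"
    using fin sym finite_star_verts
    by unfold_locales (simp_all add: symmetric_def, auto simp: star_edges_def star_verts_def)
  then show ?thesis
    unfolding subdivided_star_def by (rule pair_graph.pair_graphD_graph)
qed

lemma connected_subdivided_star: "connected (subdivided_star ls)"
proof -
  interpret graph "subdivided_star ls" by (rule graph_subdivided_star)
  have verts: "verts (subdivided_star ls) = star_verts ls"
    by (simp add: subdivided_star_def)
  have arc: "v \<rightarrow>\<^bsub>subdivided_star ls\<^esub> w \<and> w \<rightarrow>\<^bsub>subdivided_star ls\<^esub> v" if "(v, w) \<in> star_edges ls" for v w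
    using that by (auto simp: subdivided_star_def)
  have path: "None \<rightarrow>\<^sup>*\<^bsub>subdivided_star ls\<^esub> Some (i, j)" if "i < length ls" "j < ls ! i" for i j
    using that
  proof (induction j)
    case 0
    then have "(None, Some (i, 0)) \<in> star_edges ls" by (auto simp: star_edges_def)
    then show ?case using arc by blast
  next
    case (Suc j)
    then have "(Some (i, j), Some (i, Suc j)) \<in> star_edges ls" by (auto simp: star_edges_def)
    then show ?case using Suc arc by (meson Suc_lessD reachable_adj_trans)
  qed
  have from_center: "None \<rightarrow>\<^sup>*\<^bsub>subdivided_star ls\<^esub> v" if "v \<in> star_verts ls" for v
    using that path by (auto simp: star_verts_def verts)
  have "v \<rightarrow>\<^sup>*\<^bsub>subdivided_star ls\<^esub> w" if "v \<in> star_verts ls" "w \<in> star_verts ls" for v w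
    using symmetric_reachable[OF sym_arcs from_center[OF that(1)]] from_center[OF that(2)]
    by (rule reachable_trans)
  then have "(v, w) \<in> rtrancl_on (star_verts ls) ((arcs_ends (subdivided_star ls))\<^sup>s)"
    if "v \<in> star_verts ls" "w \<in> star_verts ls" for v w
    using that unfolding reachable_def verts symcl_def
    by (meson Un_upper1 order_refl rtrancl_on_mono)
  then show ?thesis
    unfolding connected_conv verts by (auto simp: star_verts_def)
qed

end

theory Submission
  imports Defs
begin

text \<open>
  A move on a star either shortens a leg by \<open>1\<close>, \<open>2\<close> or \<open>4\<close>, or removes the center and leaves a path
  inside one leg; a path with \<open>p\<close> vertices has value \<open>p mod 3\<close>. With at most two nonempty legs the star
  is itself a path. With at least three, a move through the center must remove exactly four vertices,
  so it occurs only for \<open>S\<^bsub>1,1,a\<^esub>\<close>, \<open>S\<^bsub>1,2,a\<^esub>\<close> and \<open>S\<^bsub>1,1,1,a\<^esub>\<close>, and deleting a leg of length one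
  attains the same value. Hence only the moves on the legs matter, and these are compared by induction:
  the moves from \<open>m + 3\<close> on the last leg lead to \<open>m + 2\<close>, \<open>m + 1\<close>, \<open>m - 1\<close>, each one move away from \<open>m\<close>,
  so their values differ from that of \<open>m\<close>.
\<close>

section \<open>Moves as vertex sets\<close>

text \<open>A set closed under arcs in both directions contains everything reachable from any of its
  members. Conversely, the set of vertices reachable from u is closed in this sense, so it must be
  everything. Disconnection can thus be shown by exhibiting a cut.\<close>

lemma connected_iff_no_cut:
  "connected G \<longleftrightarrow> verts G \<noteq> {} \<and>
     (\<forall>A \<subseteq> verts G. A \<noteq> {} \<longrightarrow> (\<forall>(u, v) \<in> arcs_ends G. u \<in> verts G \<longrightarrow> v \<in> verts G \<longrightarrow> (u \<in> A \<longleftrightarrow> v \<in> A)) \<longrightarrow> A = verts G)"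
  (is "_ \<longleftrightarrow> _ \<and> ?R")
proof -
  have cut: "A = verts G"
    if reach: "\<forall>u \<in> verts G. \<forall>v \<in> verts G. (u, v) \<in> rtrancl_on (verts G) ((arcs_ends G)\<^sup>s)"
      and A: "A \<subseteq> verts G" "A \<noteq> {}"
      and closed: "\<forall>(u, v) \<in> arcs_ends G. u \<in> verts G \<longrightarrow> v \<in> verts G \<longrightarrow> (u \<in> A \<longleftrightarrow> v \<in> A)" for A
  proof -
    obtain u where u: "u \<in> A" using A by auto
    have "v \<in> A" if "v \<in> verts G" for v
    proof -
      have "(u, v) \<in> rtrancl_on (verts G) ((arcs_ends G)\<^sup>s)" using reach u A that by auto
      then show ?thesis
      proof (induction rule: rtrancl_on_induct)
        case (step y z)
        then have "(y, z) \<in> arcs_ends G \<or> (z, y) \<in> arcs_ends G" by (auto simp: symcl_def)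
        then show ?case using closed step by blast
      qed (rule u)
    qed
    then show ?thesis using A by auto
  qed
  have "(u, v) \<in> rtrancl_on (verts G) ((arcs_ends G)\<^sup>s)"
    if R: ?R and u: "u \<in> verts G" and v: "v \<in> verts G" for u v
  proof -
    let ?A = "{v \<in> verts G. (u, v) \<in> rtrancl_on (verts G) ((arcs_ends G)\<^sup>s)}"
    have "x \<in> ?A \<longleftrightarrow> y \<in> ?A" if "(x, y) \<in> arcs_ends G" "x \<in> verts G" "y \<in> verts G" for x y
    proof -
      have "(x, y) \<in> (arcs_ends G)\<^sup>s" "(y, x) \<in> (arcs_ends G)\<^sup>s"
        using that(1) by (auto simp: symcl_def)
      then show ?thesis using that(2,3) rtrancl_on_into_rtrancl_on by fast
    qed
    then have "\<forall>(x, y) \<in> arcs_ends G. x \<in> verts G \<longrightarrow> y \<in> verts G \<longrightarrow> (x \<in> ?A \<longleftrightarrow> y \<in> ?A)"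
      by blast
    moreover have "u \<in> ?A" using u by simp
    ultimately have "?A = verts G" using R[rule_format, of ?A] by blast
    then show ?thesis using v by blast
  qed
  then show ?thesis unfolding connected_conv using cut by (intro conj_cong refl iffI ballI allI impI) simp_all
qed

lemma induce_subgraph_induce: "W \<subseteq> V \<Longrightarrow> (G \<restriction> V) \<restriction> W = G \<restriction> W"
  by (auto simp: induce_subgraph_def)

lemma (in wf_digraph) induce_subgraph_all_verts: "G \<restriction> verts G = G"
  by (rule pre_digraph.equality) auto

lemma (in graph) graph_induce:
  assumes "V \<subseteq> verts G"
  shows "graph (G \<restriction> V)"
proof -
  have "wf_digraph (G \<restriction> V)" using assms by (intro wellformed_induce_subgraph)
  then interpret H: wf_digraph "G \<restriction> V" .
  have "symmetric (G \<restriction> V)"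
  proof -
    have "(v, u) \<in> arcs_ends (G \<restriction> V)" if "(u, v) \<in> arcs_ends (G \<restriction> V)" for u v
    proof -
      have "(u, v) \<in> arcs_ends G" "u \<in> V" "v \<in> V"
        using that by (auto simp: arcs_ends_conv)
      moreover have "(v, u) \<in> arcs_ends G"
        using \<open>(u, v) \<in> arcs_ends G\<close> sym_arcs by (auto simp: symmetric_def sym_def)
      ultimately show ?thesis by (simp add: arcs_ends_conv image_iff) metis
    qed
    then show ?thesis by (auto simp: symmetric_def sym_def)
  qed
  moreover have "finite V" using assms finite_verts by (rule finite_subset)
  ultimately show ?thesis
    using no_multi_arcs by unfold_locales (simp_all add: no_loops arc_to_ends_def)
qed

text \<open>H spans the subgraph induced on its vertices, and adding arcs preserves
  connectedness.\<close>

lemma (in graph) connected_induce_verts: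
  assumes "subgraph H G" "connected H"
  shows "connected (G \<restriction> verts H)"
proof -
  have "verts H \<subseteq> verts G" using assms by auto
  then interpret K: graph "G \<restriction> verts H" by (rule graph_induce)
  have "spanning H (G \<restriction> verts H)"
    using assms(1) subgraph_induce_subgraphI2[OF assms(1)] by (auto simp: spanning_def)
  then show ?thesis using assms(2) K.connected_spanning_imp_connected by blast
qed

text \<open>The removed subgraph only matters through its vertex set, and may be taken induced.\<close>

lemma csg_move_induce_iff:
  assumes G: "graph G" and V: "V \<subseteq> verts G"
  shows "csg_move L (G \<restriction> V) G' \<longleftrightarrow>
    (\<exists>S \<subseteq> V. connected (G \<restriction> S) \<and> card S \<in> L \<and> G' = G \<restriction> (V - S) \<and>
       (V - S = {} \<or> connected (G \<restriction> (V - S))))"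
proof -
  interpret G: graph G by (rule G)
  interpret GV: graph "G \<restriction> V" using V by (rule G.graph_induce)
  show ?thesis
  proof
    assume "csg_move L (G \<restriction> V) G'"
    then obtain H where H: "subgraph H (G \<restriction> V)" "connected H" "card (verts H) \<in> L"
      "G' = (G \<restriction> V) \<restriction> (V - verts H)" "verts G' = {} \<or> connected G'"
      by (auto simp: csg_move_def)
    have "verts H \<subseteq> V" using H(1) by (auto simp: subgraph_def)
    moreover have "connected (G \<restriction> verts H)"
      using GV.connected_induce_verts[OF H(1,2)] \<open>verts H \<subseteq> V\<close> by (simp add: induce_subgraph_induce)
    ultimately show "\<exists>S \<subseteq> V. connected (G \<restriction> S) \<and> card S \<in> L \<and> G' = G \<restriction> (V - S) \<and>
       (V - S = {} \<or> connected (G \<restriction> (V - S)))"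
      using H(3-5) by (intro exI[of _ "verts H"]) (auto simp: induce_subgraph_induce)
  next
    assume "\<exists>S \<subseteq> V. connected (G \<restriction> S) \<and> card S \<in> L \<and> G' = G \<restriction> (V - S) \<and>
       (V - S = {} \<or> connected (G \<restriction> (V - S)))"
    then obtain S where S: "S \<subseteq> V" "connected (G \<restriction> S)" "card S \<in> L" "G' = G \<restriction> (V - S)"
      "V - S = {} \<or> connected (G \<restriction> (V - S))" by blast
    have "graph (G \<restriction> S)" using S V by (intro G.graph_induce) auto
    moreover have "subgraph (G \<restriction> S) (G \<restriction> V)"
      using GV.induced_induce[of S] S(1) by (auto simp: induce_subgraph_induce)
    ultimately show "csg_move L (G \<restriction> V) G'"
      unfolding csg_move_def using S GV.graph_axioms
      by (auto simp: induce_subgraph_induce intro!: exI[of _ "G \<restriction> S"])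
  qed
qed

section \<open>Connected sets of vertices in a star\<close>

text \<open>Every position reachable from a star is an induced subgraph of it, so positions are
  recorded as vertex sets of one fixed star.\<close>

abbreviation star_on :: "nat list \<Rightarrow> (nat \<times> nat) option set \<Rightarrow> _" where
  "star_on ls V \<equiv> subdivided_star ls \<restriction> V"

lemma verts_subdivided_star [simp]: "verts (subdivided_star ls) = star_verts ls"
  by (simp add: subdivided_star_def)

lemma star_on_star_verts: "star_on ls (star_verts ls) = subdivided_star ls"
proof -
  interpret graph "subdivided_star ls" by (rule graph_subdivided_star)
  show ?thesis using induce_subgraph_all_verts by simp
qed

lemma Some_in_star_verts [simp]: "Some (i, j) \<in> star_verts ls \<longleftrightarrow> i < length ls \<and> j < ls ! i"
  by (auto simp: star_verts_def)

lemma None_in_star_verts [simp]: "None \<in> star_verts ls"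
  by (simp add: star_verts_def)

text \<open>The end farther from the center decides: star vertices are closed under moving inwards,
  so the length bounds enter only through membership of v in \<open>star_verts ls\<close>.\<close>

lemma star_edges_iff:
  "(u, v) \<in> star_edges ls \<longleftrightarrow> v \<in> star_verts ls \<and>
     (u = None \<and> (\<exists>i. v = Some (i, 0)) \<or> (\<exists>i j. u = Some (i, j) \<and> v = Some (i, Suc j)))"
  by (auto simp: star_edges_def)

lemma star_edges_source: "(u, v) \<in> star_edges ls \<Longrightarrow> u \<in> star_verts ls"
  by (auto simp: star_edges_iff)

lemma star_verts_update_subset:
  assumes "a \<le> ls ! i"
  shows "star_verts (ls[i := a]) \<subseteq> star_verts ls"
proof
  fix v assume "v \<in> star_verts (ls[i := a])"
  then show "v \<in> star_verts ls"
    using assms by (cases v; cases "i < length ls") (auto simp: nth_list_update split: if_splits)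
qed

text \<open>Positions on a leg are numbered outwards from the center, so cutting off an outer end
  gives the smaller star itself, as an equality of digraphs and not merely up to
  isomorphism.\<close>

lemma star_on_update:
  assumes "a \<le> ls ! i"
  shows "star_on ls (star_verts (ls[i := a])) = subdivided_star (ls[i := a])"
proof -
  let ?V = "star_verts (ls[i := a])"
  have "(u, v) \<in> star_edges (ls[i := a]) \<longleftrightarrow> (u, v) \<in> star_edges ls \<and> u \<in> ?V \<and> v \<in> ?V" for u v
    using star_verts_update_subset[OF assms] star_edges_source[of u v "ls[i := a]"]
    unfolding star_edges_iff by blast
  then have "star_edges (ls[i := a]) \<union> (star_edges (ls[i := a]))\<inverse> =
      {e \<in> star_edges ls \<union> (star_edges ls)\<inverse>. fst e \<in> ?V \<and> snd e \<in> ?V}"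
    by auto
  then show ?thesis by (simp add: subdivided_star_def induce_subgraph_def with_proj_def)
qed

lemma arcs_ends_star_on:
  "arcs_ends (star_on ls V) = {(u, v). u \<in> V \<and> v \<in> V \<and> ((u, v) \<in> star_edges ls \<or> (v, u) \<in> star_edges ls)}"
  by (auto simp: subdivided_star_def arcs_ends_def arc_to_ends_def image_iff)

lemma connected_star_on_iff:
  "connected (star_on ls V) \<longleftrightarrow> V \<noteq> {} \<and>
     (\<forall>A \<subseteq> V. A \<noteq> {} \<longrightarrow> (\<forall>(u, v) \<in> star_edges ls. u \<in> V \<longrightarrow> v \<in> V \<longrightarrow> (u \<in> A \<longleftrightarrow> v \<in> A)) \<longrightarrow> A = V)"
  proof -
  have "(\<forall>(u, v) \<in> arcs_ends (star_on ls V). u \<in> V \<longrightarrow> v \<in> V \<longrightarrow> (u \<in> A \<longleftrightarrow> v \<in> A)) \<longleftrightarrow>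
      (\<forall>(u, v) \<in> star_edges ls. u \<in> V \<longrightarrow> v \<in> V \<longrightarrow> (u \<in> A \<longleftrightarrow> v \<in> A))" for A
    unfolding arcs_ends_star_on by blast
  then show ?thesis unfolding connected_iff_no_cut by simp
qed

text \<open>Working form of the cut criterion: the last two premises say that A is respected by the
  edges at the center and by the edges along a leg.\<close>

lemma connected_star_onD:
  assumes "connected (star_on ls V)" "A \<subseteq> V" "A \<noteq> {}"
    "\<And>i. None \<in> V \<Longrightarrow> Some (i, 0) \<in> V \<Longrightarrow> None \<in> A \<longleftrightarrow> Some (i, 0) \<in> A"
    "\<And>i j. Some (i, j) \<in> V \<Longrightarrow> Some (i, Suc j) \<in> V \<Longrightarrow> Some (i, j) \<in> A \<longleftrightarrow> Some (i, Suc j) \<in> A"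
  shows "A = V"
proof -
  have "\<forall>(u, v) \<in> star_edges ls. u \<in> V \<longrightarrow> v \<in> V \<longrightarrow> (u \<in> A \<longleftrightarrow> v \<in> A)"
    using assms(4,5) by (auto simp: star_edges_def)
  moreover have "\<forall>A \<subseteq> V. A \<noteq> {} \<longrightarrow>
      (\<forall>(u, v) \<in> star_edges ls. u \<in> V \<longrightarrow> v \<in> V \<longrightarrow> (u \<in> A \<longleftrightarrow> v \<in> A)) \<longrightarrow> A = V"
    using assms(1) unfolding connected_star_on_iff by (rule conjunct2)
  ultimately show ?thesis using assms(2,3) by blast
qed

text \<open>If position z were missing, the vertices of leg i beyond z would be cut off from the
  center.\<close>

lemma connected_star_on_down:
  assumes con: "connected (star_on ls V)" and N: "None \<in> V" and y: "Some (i, y) \<in> V" and z: "z \<le> y"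
  shows "Some (i, z) \<in> V"
proof (rule ccontr)
  assume nz: "Some (i, z) \<notin> V"
  let ?A = "{Some (i, j) | j. Some (i, j) \<in> V \<and> z < j}"
  have "z \<noteq> y" using nz y by auto
  then have "Some (i, y) \<in> ?A" using y z by auto
  then have "?A \<noteq> {}" by blast
  then have "?A = V"
  proof (rule connected_star_onD[OF con, rotated])
    show "Some (i', j) \<in> ?A \<longleftrightarrow> Some (i', Suc j) \<in> ?A" if "Some (i', j) \<in> V" "Some (i', Suc j) \<in> V" for i' j
      using that nz by (cases "j = z") auto
  qed auto
  then have "None \<in> ?A" using N by (rule equalityD2[THEN subsetD])
  then show False by simp
qed

text \<open>With the center present this is downward closure; without it, a gap at z separates the
  vertices beyond z from x.\<close>

lemma connected_star_on_convex:
  assumes con: "connected (star_on ls V)" and x: "Some (i, x) \<in> V" and y: "Some (i, y) \<in> V"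
    and z: "x \<le> z" "z \<le> y"
  shows "Some (i, z) \<in> V"
proof (cases "None \<in> V")
  case True
  then show ?thesis using connected_star_on_down con y z by blast
next
  case False
  show ?thesis
  proof (rule ccontr)
    assume nz: "Some (i, z) \<notin> V"
    let ?A = "{Some (i, j) | j. Some (i, j) \<in> V \<and> z < j}"
    have "z \<noteq> y" using nz y by auto
    then have "Some (i, y) \<in> ?A" using y z by auto
    then have "?A \<noteq> {}" by blast
    then have "?A = V"
    proof (rule connected_star_onD[OF con, rotated])
      show "Some (i', j) \<in> ?A \<longleftrightarrow> Some (i', Suc j) \<in> ?A" if "Some (i', j) \<in> V" "Some (i', Suc j) \<in> V" for i' j
        using that nz by (cases "j = z") auto
    qed (use False in auto)
    then have "Some (i, x) \<in> ?A" using x by (rule equalityD2[THEN subsetD])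
    then show False using z by simp
  qed
qed

text \<open>Distinct legs meet only at the center, so in its absence the part of V on one leg is
  closed under edges.\<close>

lemma connected_star_on_same_leg:
  assumes con: "connected (star_on ls V)" and N: "None \<notin> V" and x: "Some (i, x) \<in> V" and y: "Some (i', y) \<in> V"
  shows "i = i'"
proof -
  have "{Some (i, j) | j. Some (i, j) \<in> V} = V"
    by (rule connected_star_onD[OF con]) (use N x in auto)
  then have "Some (i', y) \<in> {Some (i, j) | j. Some (i, j) \<in> V}" using y by (rule equalityD2[THEN subsetD])
  then show ?thesis by simp
qed

section \<open>Segments of a leg\<close>

definition seg :: "nat \<Rightarrow> nat \<Rightarrow> nat \<Rightarrow> (nat \<times> nat) option set" where
  "seg i a b = {Some (i, j) | j. a \<le> j \<and> j < b}"

lemma Some_in_seg [simp]: "Some (i', j) \<in> seg i a b \<longleftrightarrow> i' = i \<and> a \<le> j \<and> j < b"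
  by (auto simp: seg_def)

lemma None_notin_seg [simp]: "None \<notin> seg i a b"
  by (auto simp: seg_def)

lemma seg_empty_iff [simp]: "seg i a b = {} \<longleftrightarrow> b \<le> a"
  by (auto simp: seg_def not_le)

lemma card_seg [simp]: "card (seg i a b) = b - a"
proof -
  have "seg i a b = (\<lambda>j. Some (i, j)) ` {a..<b}" by (auto simp: seg_def)
  then show ?thesis by (simp add: card_image inj_on_def)
qed

lemma seg_diff_prefix: "a \<le> c \<Longrightarrow> seg i a b - seg i a c = seg i c b"
  by (auto simp: seg_def)

lemma seg_diff_suffix: "c \<le> b \<Longrightarrow> seg i a b - seg i c b = seg i a c"
  by (auto simp: seg_def)

lemma seg_subset_star_verts: "i < length ls \<Longrightarrow> b \<le> ls ! i \<Longrightarrow> seg i a b \<subseteq> star_verts ls"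
  by (auto simp: seg_def star_verts_def)

text \<open>Walking outwards from position a, membership in a set respected by the edges never
  changes, so one member brings in the whole segment.\<close>

lemma connected_seg:
  assumes "i < length ls" "b \<le> ls ! i" "a < b"
  shows "connected (star_on ls (seg i a b))"
  unfolding connected_star_on_iff
proof (intro conjI allI impI)
  show "seg i a b \<noteq> {}" using assms by simp
next
  fix A assume A: "A \<subseteq> seg i a b" "A \<noteq> {}"
    and closed: "\<forall>(u, v) \<in> star_edges ls. u \<in> seg i a b \<longrightarrow> v \<in> seg i a b \<longrightarrow> (u \<in> A \<longleftrightarrow> v \<in> A)"
  have step: "Some (i, j) \<in> A \<longleftrightarrow> Some (i, Suc j) \<in> A" if "a \<le> j" "Suc j < b" for j
  proof -
    have "(Some (i, j), Some (i, Suc j)) \<in> star_edges ls"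
      using that assms by (auto simp: star_edges_def)
    moreover have "Some (i, j) \<in> seg i a b" "Some (i, Suc j) \<in> seg i a b" using that by auto
    ultimately show ?thesis using closed by blast
  qed
  have first: "Some (i, j) \<in> A \<longleftrightarrow> Some (i, a) \<in> A" if "a \<le> j" "j < b" for j
    using that by (induction j rule: dec_induct) (use step in auto)
  obtain v where v: "v \<in> A" "v \<in> seg i a b" using A by blast
  then obtain j where "v = Some (i, j)" "a \<le> j" "j < b" by (auto simp: seg_def)
  then have "Some (i, a) \<in> A" using first v(1) by blast
  then have "seg i a b \<subseteq> A" using first by (auto simp: seg_def)
  then show "A = seg i a b" using A(1) by blast
qed

text \<open>Such a set lies on one leg and has no gaps, hence runs from its least to its greatest
  position; the end is \<open>Suc (Max ?J)\<close> because \<open>seg\<close> excludes its upper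
  bound.\<close>

lemma connected_star_on_eq_seg:
  assumes con: "connected (star_on ls V)" and N: "None \<notin> V" and V: "V \<subseteq> star_verts ls"
  obtains i a b where "i < length ls" "a < b" "b \<le> ls ! i" "V = seg i a b"
proof -
  have "V \<noteq> {}" using con by (simp add: connected_star_on_iff)
  then obtain v where "v \<in> V" by blast
  then obtain i x where x: "Some (i, x) \<in> V" using N by (cases v) auto
  let ?J = "{j. Some (i, j) \<in> V}"
  have J: "?J \<subseteq> {..<ls ! i}" and i: "i < length ls" using V x by (auto simp: star_verts_def)
  then have fin: "finite ?J" using finite_subset by blast
  have xJ: "x \<in> ?J" using x by simp
  have mn: "Min ?J \<in> ?J" "Max ?J \<in> ?J"
    using Min_in[OF fin] Max_in[OF fin] xJ by (metis empty_iff)+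
  have all_leg: "\<exists>j. v = Some (i, j)" if "v \<in> V" for v
    using connected_star_on_same_leg[OF con N x] that N by (cases v) auto
  have "V = seg i (Min ?J) (Suc (Max ?J))"
  proof (intro set_eqI iffI)
    fix v assume v: "v \<in> V"
    then obtain j where "v = Some (i, j)" using all_leg by blast
    then show "v \<in> seg i (Min ?J) (Suc (Max ?J))" using v Min_le[OF fin, of j] Max_ge[OF fin, of j] by (simp add: less_Suc_eq_le)
  next
    fix v assume "v \<in> seg i (Min ?J) (Suc (Max ?J))"
    then obtain j where "v = Some (i, j)" "Min ?J \<le> j" "j \<le> Max ?J"
      by (auto simp: seg_def less_Suc_eq_le)
    then show "v \<in> V" using connected_star_on_convex[OF con, of i "Min ?J" "Max ?J" j] mn by simp
  qed
  moreover have "Min ?J < Suc (Max ?J)" using Min_le[OF fin xJ] Max_ge[OF fin xJ] by linarith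
  moreover have "Suc (Max ?J) \<le> ls ! i" using mn J by auto
  ultimately show ?thesis using that i by blast
qed

section \<open>Values of paths and options of stars\<close>

lemma mex_eqI:
  assumes "v \<notin> A" "\<And>u. u < v \<Longrightarrow> u \<in> A"
  shows "mex A = v"
  unfolding mex_def using assms by (intro Least_equality) (auto simp: linorder_not_less[symmetric])

text \<open>Subtracting the difference of the residues, which is 1 or 2, stays within the same block
  of three numbers. Moves of size 1 and 2 therefore reach every smaller value of a path.\<close>

lemma mod_3_predecessor:
  fixes n u :: nat
  assumes "u < n mod 3"
  obtains k where "k = 1 \<or> k = 2" "k \<le> n mod 3" "(n - k) mod 3 = u"
proof
  let ?k = "n mod 3 - u"
  have three: "n mod 3 < 3" by simp
  show "?k = 1 \<or> ?k = 2" using three assms by linarith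
  have "n - ?k = 3 * (n div 3) + u" using assms mult_div_mod_eq[of 3 n] by linarith
  moreover have "u < 3" using assms three by linarith
  ultimately show "(n - ?k) mod 3 = u" by simp
qed simp_all

text \<open>This evaluates the subtraction game with moves 1, 2 and 4: none of these is a multiple
  of 3, so the residue of n is never repeated, and every smaller residue is reached by a move of
  size 1 or 2.\<close>

lemma mex_path_values: "mex {(n - k) mod 3 | k. k \<in> {1, 2, 4} \<and> k \<le> n} = n mod 3"
proof (rule mex_eqI)
  have "(n - k) mod 3 \<noteq> n mod 3" if "k \<in> {1, 2, 4}" "k \<le> n" for k
  proof -
    have "\<not> 3 dvd n - (n - k)" using that by auto
    then show ?thesis using mod_eq_dvd_iff_nat[of "n - k" n 3] by auto
  qed
  then show "n mod 3 \<notin> {(n - k) mod 3 | k. k \<in> {1, 2, 4} \<and> k \<le> n}" by (auto simp: eq_commute[of "n mod 3"])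
next
  fix u assume u: "u < n mod 3"
  obtain k where k: "k = 1 \<or> k = 2" "k \<le> n mod 3" "(n - k) mod 3 = u"
    using mod_3_predecessor[OF u] by blast
  have "k \<le> n" using k(2) mod_less_eq_dividend[of n 3] by linarith
  moreover have "k \<in> {1, 2, 4}" using k(1) by blast
  ultimately show "u \<in> {(n - k) mod 3 | k. k \<in> {1, 2, 4} \<and> k \<le> n}" using k(3) by blast
qed

text \<open>A move on a path has to take a piece containing an end, since otherwise the remainder
  falls apart; what is left is the subtraction game on the number of vertices.\<close>

lemma grundy_seg:
  assumes "i < length ls" "b \<le> ls ! i" "a \<le> b"
  shows "grundy {1, 2, 4} (star_on ls (seg i a b)) = (b - a) mod 3"
  using assms(2,3)
proof (induction "b - a" arbitrary: a b rule: less_induct)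
  case less
  let ?L = "{1, 2, 4} :: nat set"
  have seg_sub: "seg i a b \<subseteq> verts (subdivided_star ls)"
    using seg_subset_star_verts assms(1) less.prems by simp
  note move_iff = csg_move_induce_iff[OF graph_subdivided_star seg_sub]
  have "grundy ?L ` {G'. csg_move ?L (star_on ls (seg i a b)) G'} =
      {(b - a - k) mod 3 | k. k \<in> ?L \<and> k \<le> b - a}"
  proof (intro set_eqI iffI)
    fix x assume "x \<in> grundy ?L ` {G'. csg_move ?L (star_on ls (seg i a b)) G'}"
    then obtain S where S: "S \<subseteq> seg i a b" "connected (star_on ls S)" "card S \<in> ?L"
      and W: "seg i a b - S = {} \<or> connected (star_on ls (seg i a b - S))"
      and x: "x = grundy ?L (star_on ls (seg i a b - S))"
      unfolding move_iff by blast
    have "None \<notin> S" "S \<subseteq> star_verts ls" using S(1) seg_sub by auto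
    then obtain i' c d where cd: "c < d" "S = seg i' c d"
      using connected_star_on_eq_seg[OF S(2)] by metis
    have "Some (i', c) \<in> S" "Some (i', d - 1) \<in> S" using cd by auto
    then have "Some (i', c) \<in> seg i a b" "Some (i', d - 1) \<in> seg i a b" using S(1) by blast+
    then have i': "i' = i" and c: "a \<le> c" and d: "d \<le> b" using cd by auto
    \<comment> \<open>Otherwise vertices remain on both sides of the removed piece, and convexity of
      the remainder would put the removed vertex c back into it.\<close>
    have "c = a \<or> d = b"
    proof (rule ccontr)
      assume "\<not> (c = a \<or> d = b)"
      then have ends: "Some (i, a) \<in> seg i a b - S" "Some (i, d) \<in> seg i a b - S"
        using cd c d i' by auto
      then have "connected (star_on ls (seg i a b - S))" using W by blast
      then have "Some (i, c) \<in> seg i a b - S"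
        using connected_star_on_convex ends c cd(1) less_imp_le by meson
      then show False using cd i' by simp
    qed
    then obtain a' b' where W': "seg i a b - S = seg i a' b'" "a' \<le> b'" "b' \<le> b"
      and len: "b' - a' = b - a - (d - c)"
    proof
      assume "c = a"
      then show thesis using cd c d i' that[of d b] seg_diff_prefix[of a d i b] by simp
    next
      assume "d = b"
      then show thesis using cd c d i' that[of a c] seg_diff_suffix[of c b i a] by simp
    qed
    have k: "d - c \<in> ?L" "d - c \<le> b - a" using S(3) cd c d by auto
    have "b' - a' < b - a" using len k by auto
    then have "x = (b' - a') mod 3" unfolding x W'(1) using less W' by simp
    then show "x \<in> {(b - a - k) mod 3 | k. k \<in> ?L \<and> k \<le> b - a}" using len k by (intro CollectI exI[of _ "d - c"]) simp
  next
    fix x assume "x \<in> {(b - a - k) mod 3 | k. k \<in> ?L \<and> k \<le> b - a}"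
    then obtain k where k: "k \<in> ?L" "k \<le> b - a" and x: "x = (b - a - k) mod 3" by blast
    have k0: "0 < k" using k by auto
    have "seg i a b - seg i (b - k) b = seg i a (b - k)" by (simp add: seg_diff_suffix)
    moreover have "seg i (b - k) b \<subseteq> seg i a b" using k by (auto simp: seg_def)
    moreover have "connected (star_on ls (seg i (b - k) b))"
      using connected_seg assms(1) less.prems k k0 by simp
    moreover have "seg i a (b - k) = {} \<or> connected (star_on ls (seg i a (b - k)))"
      using connected_seg[of i ls "b - k" a] assms(1) less.prems by (cases "a < b - k") auto
    moreover have "card (seg i (b - k) b) \<in> ?L" using k less.prems by auto
    ultimately have "csg_move ?L (star_on ls (seg i a b)) (star_on ls (seg i a (b - k)))"
      unfolding move_iff by (intro exI[of _ "seg i (b - k) b"]) simp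
    moreover have "grundy ?L (star_on ls (seg i a (b - k))) = x"
      using less.hyps[of "b - k" a] less.prems k k0 x by (simp add: diff_diff_eq add.commute)
    ultimately show "x \<in> grundy ?L ` {G'. csg_move ?L (star_on ls (seg i a b)) G'}" by blast
  qed
  then show ?case by (subst grundy.simps) (simp only: mex_path_values)
qed

section \<open>Vertex counts and the moves of a star\<close>

lemma card_star_verts: "card (star_verts ls) = Suc (sum_list ls)"
proof -
  have "star_verts ls = insert None (Some ` (SIGMA i:{..<length ls}. {..<ls ! i}))"
    by (auto simp: star_verts_def)
  then show ?thesis
    by (simp add: card_image card_insert_if sum_list_sum_nth atLeast0LessThan inj_on_def image_iff)
qed

lemma star_verts_diff_seg:
  assumes "i < length ls" "a \<le> ls ! i"
  shows "star_verts ls - seg i a (ls ! i) = star_verts (ls[i := a])"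
proof (rule set_eqI)
  fix v show "v \<in> star_verts ls - seg i a (ls ! i) \<longleftrightarrow> v \<in> star_verts (ls[i := a])"
    using assms by (cases v) (auto simp: nth_list_update split: if_splits)
qed

lemma star_verts_diff_update:
  assumes "i < length ls" "a \<le> ls ! i"
  shows "star_verts ls - star_verts (ls[i := a]) = seg i a (ls ! i)"
proof -
  have "star_verts ls - star_verts (ls[i := a]) = star_verts ls \<inter> seg i a (ls ! i)"
    using star_verts_diff_seg[OF assms] by blast
  then show ?thesis using seg_subset_star_verts[of i ls "ls ! i" a] assms by auto
qed

text \<open>A removed set without the center is a segment; the remainder contains the center and is
  downward closed, so the segment reaches the outer end of its leg. If the removed set contains the
  center, a nonempty remainder is a segment, and downward closure of the removed set makes it an
  outer end.\<close>

lemma csg_move_star_iff: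
  "csg_move L (subdivided_star ls) G' \<longleftrightarrow>
    (\<exists>i < length ls. \<exists>k \<in> L. 0 < k \<and> k \<le> ls ! i \<and> G' = subdivided_star (ls[i := ls ! i - k])) \<or>
    (\<exists>i < length ls. \<exists>p \<le> ls ! i. 0 < p \<and> Suc (sum_list ls) - p \<in> L \<and>
       G' = star_on ls (seg i (ls ! i - p) (ls ! i))) \<or>
    (Suc (sum_list ls) \<in> L \<and> G' = star_on ls {})" (is "_ \<longleftrightarrow> ?leg \<or> ?centre \<or> ?all")
proof -
  let ?V = "star_verts ls"
  have fin: "finite ?V" by (rule finite_star_verts)
  have "csg_move L (subdivided_star ls) G' \<longleftrightarrow>
    (\<exists>S \<subseteq> ?V. connected (star_on ls S) \<and> card S \<in> L \<and> G' = star_on ls (?V - S) \<and>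
       (?V - S = {} \<or> connected (star_on ls (?V - S))))" (is "_ \<longleftrightarrow> ?M")
    using csg_move_induce_iff[OF graph_subdivided_star, of ?V ls L G'] by (simp add: star_on_star_verts)
  also have "\<dots> \<longleftrightarrow> ?leg \<or> ?centre \<or> ?all"
  proof
    assume ?M
    then obtain S where S: "S \<subseteq> ?V" "connected (star_on ls S)" "card S \<in> L"
      and W: "?V - S = {} \<or> connected (star_on ls (?V - S))" and G': "G' = star_on ls (?V - S)"
      by blast
    show "?leg \<or> ?centre \<or> ?all"
    proof (cases "None \<in> S")
      case None: False
      obtain i a b where i: "i < length ls" and ab: "a < b" "b \<le> ls ! i" and S_eq: "S = seg i a b"
        using connected_star_on_eq_seg[OF S(2) None S(1)] .
      have N: "None \<in> ?V - S" using None by simp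
      then have con: "connected (star_on ls (?V - S))" using W by blast
      have b: "b = ls ! i"
      proof (rule ccontr)
        assume "b \<noteq> ls ! i"
        then have "Some (i, b) \<in> ?V - S" using i ab S_eq by simp
        then have "Some (i, a) \<in> ?V - S"
          by (rule connected_star_on_down[OF con N _ less_imp_le[OF ab(1)]])
        then show False using ab S_eq by simp
      qed
      let ?k = "b - a"
      have "G' = subdivided_star (ls[i := ls ! i - ?k])"
        using G' S_eq star_verts_diff_seg[OF i, of a] star_on_update[of a ls i] ab b by simp
      moreover have "?k \<in> L" using S(3) S_eq by simp
      ultimately have ?leg using i ab by (intro exI[of _ i] conjI bexI[of _ ?k]) auto
      then show ?thesis ..
    next
      case N: True
      show ?thesis
      proof (cases "?V - S = {}")
        case True
        then have "S = ?V" using S(1) by blast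
        then show ?thesis using S(3) G' card_star_verts by simp
      next
        case False
        then have con: "connected (star_on ls (?V - S))" using W by blast
        obtain i a b where i: "i < length ls" and ab: "a < b" "b \<le> ls ! i" and W_eq: "?V - S = seg i a b"
          by (rule connected_star_on_eq_seg[OF con]) (use N in auto)
        have b: "b = ls ! i"
        proof (rule ccontr)
          assume "b \<noteq> ls ! i"
          then have "Some (i, b) \<in> ?V" "Some (i, b) \<notin> ?V - S" using i ab by (simp, simp only: W_eq, simp)
          then have "Some (i, b) \<in> S" by blast
          then have "Some (i, a) \<in> S"
            by (rule connected_star_on_down[OF S(2) N _ less_imp_le[OF ab(1)]])
          moreover have "Some (i, a) \<in> ?V - S" unfolding W_eq using ab by simp
          ultimately show False by blast
        qed
        let ?p = "b - a"
        have "card S = card ?V - card (?V - S)"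
          using card_Diff_subset[OF finite_subset[OF S(1) fin] S(1)] card_mono[OF fin S(1)] by simp
        then have "card S = Suc (sum_list ls) - ?p" unfolding W_eq card_star_verts by simp
        then have "Suc (sum_list ls) - ?p \<in> L" using S(3) by simp
        moreover have "G' = star_on ls (seg i (ls ! i - ?p) (ls ! i))"
          using G' W_eq ab b by simp
        ultimately have ?centre using i ab by (intro exI[of _ i] conjI exI[of _ ?p]) auto
        then show ?thesis by blast
      qed
    qed
  next
    assume "?leg \<or> ?centre \<or> ?all"
    then consider ?leg | ?centre | ?all by blast
    then show ?M
    proof cases
      case 1
      then obtain i k where i: "i < length ls" and k: "k \<in> L" "0 < k" "k \<le> ls ! i"
        and G': "G' = subdivided_star (ls[i := ls ! i - k])" by blast
      let ?S = "seg i (ls ! i - k) (ls ! i)"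
      have W: "?V - ?S = star_verts (ls[i := ls ! i - k])"
        using star_verts_diff_seg[OF i] by simp
      have W_star: "star_on ls (?V - ?S) = subdivided_star (ls[i := ls ! i - k])"
        unfolding W by (rule star_on_update) simp
      show ?M
        by (intro exI[of _ ?S] conjI disjI2)
          (use i k G' W_star seg_subset_star_verts connected_seg connected_subdivided_star in auto)
    next
      case 2
      then obtain i p where i: "i < length ls" and p: "p \<le> ls ! i" "0 < p" "Suc (sum_list ls) - p \<in> L"
        and G': "G' = star_on ls (seg i (ls ! i - p) (ls ! i))" by blast
      \<comment> \<open>The set to remove is itself a star, with leg i shortened by its p outermost
        vertices; this gives its connectedness.\<close>
      let ?S = "star_verts (ls[i := ls ! i - p])"
      have sub: "?S \<subseteq> ?V" by (rule star_verts_update_subset) simp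
      have W: "?V - ?S = seg i (ls ! i - p) (ls ! i)"
        using star_verts_diff_update[OF i] by simp
      have "card ?S = card ?V - card (?V - ?S)"
        using card_Diff_subset[OF finite_subset[OF sub fin] sub] card_mono[OF fin sub] by simp
      then have card: "card ?S \<in> L" unfolding W card_star_verts using p by simp
      have S_star: "star_on ls ?S = subdivided_star (ls[i := ls ! i - p])"
        by (rule star_on_update) simp
      show ?M
        by (rule exI[of _ ?S], unfold W S_star)
          (use i p G' sub card connected_seg connected_subdivided_star in auto)
    next
      case 3
      then show ?M
        by (intro exI[of _ ?V])
          (simp add: card_star_verts star_on_star_verts connected_subdivided_star)
    qed
  qed
  finally show ?thesis .
qed

section \<open>Values of the options of a star\<close>

definition star_value :: "nat list \<Rightarrow> nat" where
  "star_value ls = grundy {1, 2, 4} (subdivided_star ls)"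

definition leg_values :: "nat list \<Rightarrow> nat set" where
  "leg_values ls = {star_value (ls[i := ls ! i - k]) | i k.
     i < length ls \<and> k \<in> {1, 2, 4} \<and> k \<le> ls ! i}"

text \<open>Removing the centre leaves a path of \<open>p\<close> vertices inside one leg, whose value is \<open>p mod 3\<close>.\<close>

definition centre_values :: "nat list \<Rightarrow> nat set" where
  "centre_values ls = {p mod 3 | p. (\<exists>l \<in> set (0 # ls). p \<le> l) \<and> Suc (sum_list ls) - p \<in> {1, 2, 4}}"

lemma grundy_empty: "grundy L (star_on ls {}) = 0"
proof -
  have "{G'. csg_move L (star_on ls {}) G'} = {}"
    using csg_move_induce_iff[OF graph_subdivided_star, of "{}" ls L]
    by (auto simp: connected_iff_no_cut)
  then show ?thesis by (subst grundy.simps, simp only:) (simp add: mex_def)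
qed

text \<open>Combines the classification of moves with the values of segments. Removing the whole
  star has value 0 and is the case p = 0 of \<open>centre_values\<close>; the extra entry in
  \<open>0 # ls\<close> admits it even when there are no legs.\<close>

lemma star_value_eq_mex:
  "star_value ls = mex (leg_values ls \<union> centre_values ls)"
proof -
  let ?L = "{1, 2, 4} :: nat set" and ?n = "Suc (sum_list ls)"
  have seg: "grundy ?L (star_on ls (seg i (ls ! i - p) (ls ! i))) = p mod 3"
    if "i < length ls" "p \<le> ls ! i" for i p
    using grundy_seg[of i ls "ls ! i" "ls ! i - p"] that by simp
  have "grundy ?L ` {G'. csg_move ?L (subdivided_star ls) G'} = leg_values ls \<union> centre_values ls"
  proof (intro set_eqI iffI)
    fix x assume "x \<in> grundy ?L ` {G'. csg_move ?L (subdivided_star ls) G'}"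
    then obtain G' where G': "csg_move ?L (subdivided_star ls) G'" and x: "x = grundy ?L G'" by blast
    from G'[unfolded csg_move_star_iff] show "x \<in> leg_values ls \<union> centre_values ls"
    proof (elim disjE)
      assume "\<exists>i < length ls. \<exists>k \<in> ?L. 0 < k \<and> k \<le> ls ! i \<and> G' = subdivided_star (ls[i := ls ! i - k])"
      then show ?thesis unfolding x leg_values_def star_value_def by blast
    next
      assume "\<exists>i < length ls. \<exists>p \<le> ls ! i. 0 < p \<and> ?n - p \<in> ?L \<and>
         G' = star_on ls (seg i (ls ! i - p) (ls ! i))"
      then obtain i p where ip: "i < length ls" "p \<le> ls ! i" "?n - p \<in> ?L"
        and G': "G' = star_on ls (seg i (ls ! i - p) (ls ! i))" by blast
      then have "x = p mod 3" "\<exists>l \<in> set (0 # ls). p \<le> l" using x seg nth_mem by auto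
      then show ?thesis unfolding centre_values_def using ip(3) by blast
    next
      assume "?n \<in> ?L \<and> G' = star_on ls {}"
      then have "x = 0 mod 3" "?n - 0 \<in> ?L" "\<exists>l \<in> set (0 # ls). 0 \<le> l" using x grundy_empty by auto
      then show ?thesis unfolding centre_values_def by blast
    qed
  next
    fix x assume "x \<in> leg_values ls \<union> centre_values ls"
    then show "x \<in> grundy ?L ` {G'. csg_move ?L (subdivided_star ls) G'}"
    proof
      assume "x \<in> leg_values ls"
      then obtain i k where ik: "i < length ls" "k \<in> ?L" "k \<le> ls ! i"
        and x: "x = grundy ?L (subdivided_star (ls[i := ls ! i - k]))" unfolding leg_values_def star_value_def by blast
      then have "0 < k" by auto
      then have "csg_move ?L (subdivided_star ls) (subdivided_star (ls[i := ls ! i - k]))"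
        unfolding csg_move_star_iff using ik by blast
      then show ?thesis using x by blast
    next
      assume "x \<in> centre_values ls"
      then obtain p l where p: "l \<in> set (0 # ls)" "p \<le> l" "?n - p \<in> ?L" and x: "x = p mod 3"
        unfolding centre_values_def by blast
      show ?thesis
      proof (cases "p = 0")
        case True
        then have "csg_move ?L (subdivided_star ls) (star_on ls {})"
          unfolding csg_move_star_iff using p by simp
        moreover have "x = grundy ?L (star_on ls {})" using x True grundy_empty by simp
        ultimately show ?thesis by blast
      next
        case False
        then have "l \<in> set ls" using p by auto
        then obtain i where i: "i < length ls" "p \<le> ls ! i" using p by (auto simp: in_set_conv_nth)
        then have "csg_move ?L (subdivided_star ls) (star_on ls (seg i (ls ! i - p) (ls ! i)))"
          unfolding csg_move_star_iff using p(3) False by blast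
        moreover have "x = grundy ?L (star_on ls (seg i (ls ! i - p) (ls ! i)))" using x seg i by simp
        ultimately show ?thesis by blast
      qed
    qed
  qed
  then show ?thesis unfolding star_value_def by (subst grundy.simps) simp
qed

lemma leg_valuesI:
  assumes "i < length ls" "k \<in> {1, 2, 4}" "k \<le> ls ! i"
  shows "star_value (ls[i := ls ! i - k]) \<in> leg_values ls"
  unfolding leg_values_def by (rule CollectI, rule exI[of _ i], rule exI[of _ k]) (simp add: assms[simplified])

lemma leg_valuesE:
  assumes "x \<in> leg_values ls"
  obtains i k where "i < length ls" "k \<in> {1, 2, 4}" "k \<le> ls ! i" "0 < k"
    "x = star_value (ls[i := ls ! i - k])"
proof -
  obtain i k where ik: "i < length ls" "k \<in> {1, 2, 4}" "k \<le> ls ! i"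
    and x: "x = star_value (ls[i := ls ! i - k])"
    using assms unfolding leg_values_def by blast
  have pos: "0 < k" using ik(2) by auto
  from ik pos x show thesis by (rule that)
qed

text \<open>Finiteness guarantees that an excluded value exists, so that the \<open>LEAST\<close> in
  \<open>mex\<close> is meaningful.\<close>

lemma finite_move_values: "finite (leg_values ls \<union> centre_values ls)"
proof -
  have "leg_values ls \<subseteq> (\<Union>i \<in> {..<length ls}. (\<lambda>k. star_value (ls[i := ls ! i - k])) ` {1, 2, 4})"
    unfolding leg_values_def by blast
  then have "finite (leg_values ls)" by (rule finite_subset) simp
  moreover have "centre_values ls \<subseteq> {..<3}"
  proof
    fix x assume "x \<in> centre_values ls"
    then obtain p where "x = p mod 3" unfolding centre_values_def by blast
    then show "x \<in> {..<3}" by simp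
  qed
  then have "finite (centre_values ls)" by (rule finite_subset) simp
  ultimately show ?thesis by (rule finite_UnI)
qed

lemma mex_notin:
  assumes "finite A"
  shows "mex A \<notin> A"
proof -
  obtain n where "n \<notin> A" using ex_new_if_finite[OF infinite_UNIV_nat assms] by blast
  then show ?thesis unfolding mex_def by (rule LeastI)
qed

lemma less_mexD: "u < mex A \<Longrightarrow> u \<in> A"
  unfolding mex_def by (drule not_less_Least) simp

lemma less_star_valueD: "u < star_value ls \<Longrightarrow> u \<in> leg_values ls \<union> centre_values ls"
  unfolding star_value_eq_mex by (rule less_mexD)

text \<open>A position never shares its value with one of its options; this drives the exclusion
  half of the periodicity argument.\<close>

lemma star_value_leg_move_neq:
  assumes "i < length ls" "k \<in> {1, 2, 4}" "k \<le> ls ! i"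
  shows "star_value (ls[i := ls ! i - k]) \<noteq> star_value ls"
proof -
  have "star_value ls \<notin> leg_values ls \<union> centre_values ls"
    unfolding star_value_eq_mex[of ls] by (rule mex_notin) (rule finite_move_values)
  then show ?thesis using leg_valuesI[OF assms] by (metis UnI1)
qed

section \<open>Periodicity\<close>

text \<open>Entries 0 stand for absent legs; the number of these indices tells whether the star is a
  path, namely when it is at most two.\<close>

definition nonzero_legs :: "nat list \<Rightarrow> nat set" where
  "nonzero_legs ls = {i. i < length ls \<and> 0 < ls ! i}"

lemma finite_nonzero_legs [simp]: "finite (nonzero_legs ls)"
  by (simp add: nonzero_legs_def)

lemma nonzero_legs_update:
  assumes "i < length ls"
  shows "nonzero_legs (ls[i := a]) = (if a = 0 then nonzero_legs ls - {i} else insert i (nonzero_legs ls))"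
proof (rule set_eqI)
  fix j show "j \<in> nonzero_legs (ls[i := a]) \<longleftrightarrow>
      j \<in> (if a = 0 then nonzero_legs ls - {i} else insert i (nonzero_legs ls))"
    using assms by (cases "j = i") (auto simp: nonzero_legs_def)
qed

lemma card_nonzero_legs_decrease:
  assumes "i < length ls"
  shows "card (nonzero_legs (ls[i := ls ! i - k])) \<le> card (nonzero_legs ls)"
proof (rule card_mono)
  show "nonzero_legs (ls[i := ls ! i - k]) \<subseteq> nonzero_legs ls"
  proof
    fix j assume "j \<in> nonzero_legs (ls[i := ls ! i - k])"
    then show "j \<in> nonzero_legs ls"
      using assms by (cases "j = i") (auto simp: nonzero_legs_def)
  qed
qed simp

lemma sum_list_nonzero_legs: "sum_list ls = (\<Sum>i \<in> nonzero_legs ls. ls ! i)"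
proof -
  have "sum_list ls = (\<Sum>i < length ls. ls ! i)" by (simp add: sum_list_sum_nth atLeast0LessThan)
  also have "\<dots> = (\<Sum>i \<in> nonzero_legs ls. ls ! i)"
    by (rule sum.mono_neutral_right) (auto simp: nonzero_legs_def)
  finally show ?thesis .
qed

lemma sum_list_decrease:
  fixes ls :: "nat list"
  assumes "i < length ls" "k \<le> ls ! i"
  shows "sum_list (ls[i := ls ! i - k]) = sum_list ls - k" "k \<le> sum_list ls"
  using assms elem_le_sum_list[of i ls] by (auto simp: sum_list_update)

text \<open>Each index contributes at least 1. In the second bound this is used for the indices
  other than j, and \<open>Suc\<close> makes up for j being counted in
  \<open>card J\<close>.\<close>

lemma sum_card_bound:
  fixes g :: "'a \<Rightarrow> nat"
  assumes "finite J" "\<And>j. j \<in> J \<Longrightarrow> 0 < g j"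
  shows "card J \<le> sum g J" "j \<in> J \<Longrightarrow> g j + card J \<le> Suc (sum g J)"
proof -
  have le: "card I \<le> sum g I" if "I \<subseteq> J" for I
    using sum_bounded_below[of I 1 g] assms(2) that by (auto simp: Suc_le_eq)
  show "card J \<le> sum g J" using le by simp
  show "g j + card J \<le> Suc (sum g J)" if "j \<in> J"
    using le[OF Diff_subset, of "{j}"] sum.remove[OF assms(1) that, of g] card.remove[OF assms(1) that]
    by linarith
qed

section \<open>Closed forms for paths and for S_{1,1,a}\<close>

text \<open>The star is a path with \<open>Suc (sum_list ls)\<close> vertices. Its options are
  matched with those of the subtraction game: leg moves by induction, and a move through the center
  leaving p vertices by its size \<open>?n - p\<close>.\<close>

lemma star_value_path:
  assumes "card (nonzero_legs ls) \<le> 2"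
  shows "star_value ls = Suc (sum_list ls) mod 3"
  using assms
proof (induction "sum_list ls" arbitrary: ls rule: less_induct)
  case less
  let ?n = "Suc (sum_list ls)"
  have leg: "star_value (ls[i := ls ! i - k]) = (?n - k) mod 3"
    if "i < length ls" "k \<in> {1, 2, 4}" "k \<le> ls ! i" for i k
  proof -
    note dec = sum_list_decrease[OF that(1,3)]
    have "0 < k" using that(2) by auto
    then have "star_value (ls[i := ls ! i - k]) = Suc (sum_list (ls[i := ls ! i - k])) mod 3"
      using less.hyps dec card_nonzero_legs_decrease[OF that(1), of k] less.prems by simp
    then show ?thesis using dec by (simp add: Suc_diff_le)
  qed
  have "leg_values ls \<union> centre_values ls = {(?n - k) mod 3 | k. k \<in> {1, 2, 4} \<and> k \<le> ?n}"
  proof (intro set_eqI iffI)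
    fix x assume "x \<in> leg_values ls \<union> centre_values ls"
    then show "x \<in> {(?n - k) mod 3 | k. k \<in> {1, 2, 4} \<and> k \<le> ?n}"
    proof
      assume "x \<in> leg_values ls"
      then obtain i k where ik: "i < length ls" "k \<in> {1, 2, 4}" "k \<le> ls ! i"
        and x: "x = star_value (ls[i := ls ! i - k])" by (rule leg_valuesE)
      then have "x = (?n - k) mod 3" "k \<le> ?n" using leg sum_list_decrease(2) by auto
      then show ?thesis using ik(2) by blast
    next
      assume "x \<in> centre_values ls"
      then obtain p where p: "?n - p \<in> {1, 2, 4}" "x = p mod 3" unfolding centre_values_def by blast
      then have "p \<le> ?n" by auto
      then show ?thesis using p by (intro CollectI exI[of _ "?n - p"]) simp
    qed
  next
    fix x assume "x \<in> {(?n - k) mod 3 | k. k \<in> {1, 2, 4} \<and> k \<le> ?n}"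
    then obtain k where k: "k \<in> {1, 2, 4}" "k \<le> ?n" and x: "x = (?n - k) mod 3" by blast
    show "x \<in> leg_values ls \<union> centre_values ls"
    proof (cases "\<exists>i < length ls. k \<le> ls ! i")
      case True
      then show ?thesis using leg leg_valuesI k x by (metis UnI1)
    next
      case False
      \<comment> \<open>Every leg is shorter than k, so the move has to take the center. At most two
        legs, the longest of length M, give \<open>sum_list ls\<close> \<le> 2 * M; with M < k at
        most M vertices remain, and they fit inside a longest leg.\<close>
      define M where "M = Max (set (0 # ls))"
      have M: "M \<in> set (0 # ls)" "\<And>l. l \<in> set ls \<Longrightarrow> l \<le> M"
        unfolding M_def by (rule Max_in; simp) (rule Max_ge; simp)
      have "sum_list ls \<le> card (nonzero_legs ls) * M"
        unfolding sum_list_nonzero_legs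
        using sum_bounded_above[of "nonzero_legs ls" "\<lambda>i. ls ! i" M] M(2)
        by (simp add: nonzero_legs_def)
      also have "\<dots> \<le> 2 * M" using less.prems by simp
      finally have "sum_list ls \<le> 2 * M" .
      moreover have "M < k" using M(1) False k(1) by (auto simp: in_set_conv_nth not_le)
      ultimately have "?n - k \<le> M" by linarith
      moreover have "?n - (?n - k) \<in> {1, 2, 4}" using k by simp
      ultimately have "x \<in> centre_values ls" unfolding centre_values_def using M(1) x by blast
      then show ?thesis ..
    qed
  qed
  then show ?case by (simp only: star_value_eq_mex mex_path_values)
qed

text \<open>The star is S_{1,1,a} with a the length of leg i. Shortening that leg acts as
  subtraction on a, while deleting a unit leg and moving through the center both give (a - 1) mod 3,
  so the values are those of the subtraction game on a.\<close>

lemma star_value_one_one: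
  assumes "card (nonzero_legs ls) = 3" "i < length ls" "sum_list ls = ls ! i + 2"
  shows "star_value ls = ls ! i mod 3"
  using assms
proof (induction "ls ! i" arbitrary: ls rule: less_induct)
  case less
  let ?a = "ls ! i" and ?J = "nonzero_legs ls - {i}"
  note i = less.prems(2)
  have pos: "0 < ls ! j" if "j \<in> nonzero_legs ls" for j using that by (simp add: nonzero_legs_def)
  \<comment> \<open>Three nonempty legs have at least three vertices in total, while the legs other
    than i have only two.\<close>
  have a: "0 < ?a"
    using sum_card_bound(1)[of "nonzero_legs ls" "\<lambda>j. ls ! j"] pos less.prems
    by (simp add: sum_list_nonzero_legs[symmetric])
  then have i_nz: "i \<in> nonzero_legs ls" using i by (simp add: nonzero_legs_def)
  then have J: "card ?J = 2" "(\<Sum>j \<in> ?J. ls ! j) = 2"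
    using less.prems sum.remove[of "nonzero_legs ls" i "\<lambda>j. ls ! j"]
    by (simp_all add: sum_list_nonzero_legs)
  \<comment> \<open>Two nonempty legs with two vertices in total have length 1 each.\<close>
  have one: "ls ! j = 1" if "j \<in> ?J" for j
  proof -
    have "ls ! j + card ?J \<le> Suc (\<Sum>j \<in> ?J. ls ! j)"
      by (rule sum_card_bound(2)) (use pos that in auto)
    moreover have "0 < ls ! j" using pos that by blast
    ultimately show ?thesis using J by linarith
  qed
  have own: "star_value (ls[i := ?a - k]) = (?a - k) mod 3" if "k \<in> {1, 2, 4}" "k \<le> ?a" for k
  proof -
    have "0 < k" using that by auto
    have sum: "sum_list (ls[i := ?a - k]) = ?a - k + 2"
      using sum_list_decrease[OF i that(2)] less.prems(3) that(2) by simp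
    show ?thesis
    proof (cases "?a - k = 0")
      \<comment> \<open>Leg i is used up, leaving a path of three vertices, of value 0.\<close>
      case True
      then have "card (nonzero_legs (ls[i := ?a - k])) \<le> 2" using nonzero_legs_update[OF i] J by simp
      then show ?thesis using star_value_path sum True by simp
    next
      case False
      then have "card (nonzero_legs (ls[i := ?a - k])) = 3"
        using nonzero_legs_update[OF i] i_nz less.prems(1) by (simp add: insert_absorb)
      then show ?thesis using less.hyps[of "ls[i := ?a - k]"] i a \<open>0 < k\<close> sum by simp
    qed
  qed
  have other: "star_value (ls[j := ls ! j - k]) = (?a - 1) mod 3"
    if "j < length ls" "k \<in> {1, 2, 4}" "k \<le> ls ! j" "j \<noteq> i" for j k
  proof -
    have "0 < k" using that(2) by auto
    then have j: "j \<in> ?J" using that by (simp add: nonzero_legs_def)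
    then have k: "ls ! j - k = 0" "k = 1" using one[OF j] that \<open>0 < k\<close> by auto
    have "card (nonzero_legs (ls[j := ls ! j - k])) \<le> 2"
      using nonzero_legs_update[OF that(1)] j less.prems(1) k by simp
    then have "star_value (ls[j := ls ! j - k]) = Suc (sum_list ls - k) mod 3"
      using star_value_path sum_list_decrease[OF that(1,3)] by simp
    also have "\<dots> = (?a - 1) mod 3" proof -
      \<comment> \<open>Deleting a unit leg leaves a path of \<open>?a + 2\<close> vertices, which
        is congruent to \<open>?a - 1\<close> modulo 3.\<close>
      have "Suc (sum_list ls - k) = ?a - 1 + 3" using less.prems(3) a k(2) by simp
      then show ?thesis by (simp only: mod_add_self2)
    qed
    finally show ?thesis .
  qed
  have "leg_values ls \<union> centre_values ls = {(?a - k) mod 3 | k. k \<in> {1, 2, 4} \<and> k \<le> ?a}"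
  proof (intro set_eqI iffI)
    have one_move: "(?a - 1) mod 3 \<in> {(?a - k) mod 3 | k. k \<in> {1, 2, 4} \<and> k \<le> ?a}"
      using a by (intro CollectI exI[of _ 1]) auto
    fix x assume "x \<in> leg_values ls \<union> centre_values ls"
    then show "x \<in> {(?a - k) mod 3 | k. k \<in> {1, 2, 4} \<and> k \<le> ?a}"
    proof
      assume "x \<in> leg_values ls"
      then obtain j k where jk: "j < length ls" "k \<in> {1, 2, 4}" "k \<le> ls ! j"
        and x: "x = star_value (ls[j := ls ! j - k])" by (rule leg_valuesE)
      show ?thesis
      proof (cases "j = i")
        case True
        then show ?thesis using own jk x by blast
      next
        case False
        then show ?thesis using other[OF jk] one_move x by simp
      qed
    next
      assume "x \<in> centre_values ls"
      then obtain p l where p: "l \<in> set (0 # ls)" "p \<le> l" "Suc (sum_list ls) - p \<in> {1, 2, 4}"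
        and x: "x = p mod 3" unfolding centre_values_def by blast
      have "l \<le> ?a"
      proof (cases "l = 0")
        case False
        then obtain j where j: "j < length ls" "l = ls ! j" "j \<in> nonzero_legs ls"
          using p(1) by (auto simp: in_set_conv_nth nonzero_legs_def)
        then show ?thesis using one[of j] a by (cases "j = i") auto
      qed simp
      \<comment> \<open>The star has \<open>?a + 3\<close> vertices and p \<le> \<open>?a\<close>,
        so at least three are removed and the size must be 4.\<close>
      then have "p = ?a - 1" using p less.prems(3) by auto
      then show ?thesis using x one_move by simp
    qed
  next
    fix x assume "x \<in> {(?a - k) mod 3 | k. k \<in> {1, 2, 4} \<and> k \<le> ?a}"
    then show "x \<in> leg_values ls \<union> centre_values ls" using own leg_valuesI[OF i] by force
  qed
  then show ?case by (simp only: star_value_eq_mex mex_path_values)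
qed

text \<open>With three nonempty legs a move through the centre removes exactly four vertices, so the other
  legs have at most three vertices in total; removing a leg of length one has the same value.\<close>

lemma centre_values_subset:
  assumes "3 \<le> card (nonzero_legs ls)"
  shows "centre_values ls \<subseteq> leg_values ls"
proof
  fix x assume "x \<in> centre_values ls"
  then obtain p l where p: "l \<in> set (0 # ls)" "p \<le> l" "Suc (sum_list ls) - p \<in> {1, 2, 4}"
    and x: "x = p mod 3" unfolding centre_values_def by blast
  have pos: "0 < ls ! j" if "j \<in> nonzero_legs ls" for j using that by (simp add: nonzero_legs_def)
  \<comment> \<open>Leg i is chosen to have room for p vertices; if l = 0 then p = 0 and any
    nonempty leg will do.\<close>
  obtain i where i: "i \<in> nonzero_legs ls" "p \<le> ls ! i"
  proof (cases "l = 0")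
    case True
    moreover have "nonzero_legs ls \<noteq> {}" using assms by auto
    ultimately show thesis using that p(2) by auto
  next
    case False
    then show thesis using that p by (auto simp: in_set_conv_nth nonzero_legs_def)
  qed
  then have i_len: "i < length ls" by (simp add: nonzero_legs_def)
  let ?a = "ls ! i" and ?J = "nonzero_legs ls - {i}"
  define r where "r = (\<Sum>j \<in> ?J. ls ! j)"
  have sum: "sum_list ls = ?a + r"
    unfolding r_def sum_list_nonzero_legs using i(1) by (simp add: sum.remove)
  have J: "2 \<le> card ?J" using assms i(1) by simp
  have J_r: "card ?J \<le> r" unfolding r_def using pos by (intro sum_card_bound(1)) auto
  \<comment> \<open>The move removes 1 + r + (\<open>?a\<close> - p) vertices with r \<ge> 2, so the
    only admissible size is 4.\<close>
  have four: "r + ?a = p + 3" using p(3) sum J J_r i(2) by auto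
  \<comment> \<open>If the legs other than i, at least two in number, all had length at least 2,
    then r would be at least 4, whereas r \<le> 3.\<close>
  have "\<exists>j \<in> ?J. ls ! j = 1"
  proof (rule ccontr)
    assume none: "\<not> (\<exists>j \<in> ?J. ls ! j = 1)"
    have "2 \<le> ls ! j" if "j \<in> ?J" for j
    proof -
      have "0 < ls ! j" "ls ! j \<noteq> 1" using pos none that by blast+
      then show ?thesis by linarith
    qed
    then have "card ?J * 2 \<le> r" unfolding r_def using sum_bounded_below[of ?J 2 "\<lambda>j. ls ! j"] by simp
    then show False using J four i(2) by simp
  qed
  then obtain j where j: "j \<in> ?J" "ls ! j = 1" by blast
  then have j_len: "j < length ls" by (simp add: nonzero_legs_def)
  let ?ls = "ls[j := ls ! j - 1]"
  have nz: "nonzero_legs ?ls = nonzero_legs ls - {j}" using nonzero_legs_update[OF j_len] j(2) by simp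
  have card: "card (nonzero_legs ?ls) = card ?J" using nz j(1) i(1) by simp
  have sum': "sum_list ?ls = ?a + r - 1" using sum_list_decrease(1)[OF j_len, of 1] j(2) sum by simp
  \<comment> \<open>After deleting the unit leg, p + 3 vertices remain. If two nonempty legs are
    left, this is a path of value p mod 3. If three are left, the legs other than i were three units
    and p = \<open>?a\<close>, so the result is S_{1,1,p}.\<close>
  have "star_value ?ls = x"
  proof (cases "card ?J = 2")
    case True
    then have "star_value ?ls = Suc (?a + r - 1) mod 3" using star_value_path card sum' by simp
    then show ?thesis using x four J J_r by (simp add: add.commute)
  next
    case False
    then have "r = 3" "card ?J = 3" "p = ?a" using J J_r four i(2) by auto
    then show ?thesis
      using star_value_one_one[of ?ls i] card i_len sum' j(1) x by simp
  qed
  then show "x \<in> leg_values ls" using leg_valuesI[OF j_len, of 1] j(2) by auto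
qed

section \<open>Smaller values through leg moves, and period three\<close>

text \<open>The case of exactly two legs arises in the periodicity proof when an empty leg is
  lengthened to 3. There the star is a path, and a smaller residue is reached by removing 1 or 2
  vertices from a leg with room for them.\<close>

lemma less_star_value_in_leg_values:
  assumes "2 \<le> card (nonzero_legs ls)" "u < star_value ls"
  shows "u \<in> leg_values ls"
proof (cases "3 \<le> card (nonzero_legs ls)")
  case True
  then show ?thesis using less_star_valueD[OF assms(2)] centre_values_subset by blast
next
  case False
  then have card: "card (nonzero_legs ls) = 2" using assms(1) by simp
  have pos: "0 < ls ! j" if "j \<in> nonzero_legs ls" for j using that by (simp add: nonzero_legs_def)
  have val: "star_value ls = Suc (sum_list ls) mod 3" using star_value_path card by simp
  obtain k where k: "k = 1 \<or> k = 2" "k \<le> Suc (sum_list ls) mod 3" "(Suc (sum_list ls) - k) mod 3 = u"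
    using mod_3_predecessor assms(2) val by metis
  \<comment> \<open>This gives k \<le> \<open>sum_list ls\<close>, so \<open>Suc\<close> can be
    moved out of the truncated subtraction.\<close>
  have "2 \<le> sum_list ls"
    using sum_card_bound(1)[of "nonzero_legs ls" "\<lambda>j. ls ! j"] pos card
    by (simp add: sum_list_nonzero_legs[symmetric])
  then have u: "u = Suc (sum_list ls - k) mod 3" using k by (auto simp: Suc_diff_le)
  \<comment> \<open>Room is lacking only for k = 2 and two unit legs; that is a path of three
    vertices, whose value 0 has nothing below it.\<close>
  have "\<exists>j \<in> nonzero_legs ls. k \<le> ls ! j"
  proof (rule ccontr)
    assume contra: "\<not> (\<exists>j \<in> nonzero_legs ls. k \<le> ls ! j)"
    moreover have "nonzero_legs ls \<noteq> {}" using card by auto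
    ultimately have "k \<noteq> 1" using pos by (auto simp: Suc_le_eq)
    then have "k = 2" using k(1) by simp
    then have "ls ! j = 1" if "j \<in> nonzero_legs ls" for j using contra pos[OF that] that by force
    then have "sum_list ls = 2" unfolding sum_list_nonzero_legs using card by simp
    then show False using \<open>k = 2\<close> k(2) by simp
  qed
  then obtain j where j: "j < length ls" "k \<le> ls ! j" by (auto simp: nonzero_legs_def)
  have "star_value (ls[j := ls ! j - k]) = u"
    using star_value_path[of "ls[j := ls ! j - k]"] card_nonzero_legs_decrease[OF j(1), of k]
      card sum_list_decrease[OF j] u by simp
  then show ?thesis using leg_valuesI[OF j(1) _ j(2)] k(1) by auto
qed

text \<open>The lengthened leg is an arbitrary index and the induction is on the total size, so the
  hypothesis applies after a move on any leg. When both stars are paths, their lengths differ by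
  3.\<close>

lemma star_value_add_three:
  assumes "i < length ls"
  shows "star_value (ls[i := ls ! i + 3]) = star_value ls"
  using assms
proof (induction "sum_list ls" arbitrary: ls rule: less_induct)
  case less
  note i = less.prems
  let ?m = "ls ! i"
  let ?ls = "ls[i := ?m + 3]"
  have nz: "nonzero_legs ?ls = insert i (nonzero_legs ls)" using nonzero_legs_update[OF i] by simp
  show ?case
  proof (cases "card (nonzero_legs ?ls) \<le> 2")
    case True
    then have "card (nonzero_legs ls) \<le> 2"
      using card_mono[OF finite_nonzero_legs, of "nonzero_legs ls" ?ls] unfolding nz by fastforce
    moreover have "sum_list ?ls = sum_list ls + 3"
      using i elem_le_sum_list[OF i] by (simp add: sum_list_update)
    moreover have "Suc (sum_list ls + 3) mod 3 = Suc (sum_list ls) mod 3" by presburger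
    ultimately show ?thesis using star_value_path[OF True] star_value_path[of ls] by simp
  next
    case False
    \<comment> \<open>Looking up leg i after the update of leg j treats j = i and j \<noteq> i
      together.\<close>
    have IH: "star_value (ls[j := ls ! j - k, i := ls[j := ls ! j - k] ! i + 3]) = star_value (ls[j := ls ! j - k])"
      if "j < length ls" "k \<in> {1, 2, 4}" "k \<le> ls ! j" for j k
    proof -
      have "0 < k" using that(2) by auto
      then show ?thesis using less.hyps i sum_list_decrease[OF that(1,3)] by simp
    qed
    have other: "star_value (?ls[j := ?ls ! j - k]) = star_value (ls[j := ls ! j - k])"
      if "j < length ls" "k \<in> {1, 2, 4}" "k \<le> ls ! j" "j \<noteq> i" for j k
      using IH[OF that(1-3)] that(4) by (simp add: list_update_swap)
    have own: "star_value (?ls[i := ?ls ! i - k]) = star_value (ls[i := ?m - k])"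
      if "k \<in> {1, 2, 4}" "k \<le> ?m" for k
      using IH[OF i that] i that(2) by simp
    \<comment> \<open>The longer star has at least three nonempty legs, so its options through the
      center add no values and the \<open>mex\<close> runs over leg moves alone.\<close>
    have "3 \<le> card (nonzero_legs ?ls)" using False by simp
    then have "star_value ?ls = mex (leg_values ?ls)"
      using centre_values_subset star_value_eq_mex[of ?ls] by (simp add: Un_absorb2)
    also have "\<dots> = star_value ls"
    proof (rule mex_eqI)
      show "star_value ls \<notin> leg_values ?ls"
      proof
        assume "star_value ls \<in> leg_values ?ls"
        then obtain j k where jk: "j < length ls" "k \<in> {1, 2, 4}" "k \<le> ?ls ! j"
          and eq: "star_value ls = star_value (?ls[j := ?ls ! j - k])"
          by (rule leg_valuesE) simp
        show False
        proof (cases "j = i")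
          case False
          then show False using other jk eq star_value_leg_move_neq[of j ls k] by simp
        next
          case True
          \<comment> \<open>Here \<open>ls\<close> is an option of the lengthened star: removing d
            vertices leads back to it.\<close>
          have revert: "star_value (ls[i := ?m + d]) \<noteq> star_value ls" if "d \<in> {1, 2, 4}" for d
            using star_value_leg_move_neq[of i "ls[i := ?m + d]" d] i that by simp
          have "k = 1 \<or> k = 2 \<or> k = 4" using jk(2) by simp
          then show False
          proof (elim disjE)
            assume "k = 1"
            then show False using revert[of 2] eq True i by (simp add: numeral_eq_Suc)
          next
            assume "k = 2"
            then show False using revert[of 1] eq True i by (simp add: numeral_eq_Suc)
          next
            \<comment> \<open>Now 4 \<le> \<open>?m + 3\<close>, so \<open>?m\<close> \<ge> 1 and
              the resulting length \<open>?m - 1\<close> is a move of size 1 from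
              \<open>ls\<close>.\<close>
            assume "k = 4"
            then show False using star_value_leg_move_neq[OF i, of 1] eq True i jk(3)
              by (simp add: numeral_eq_Suc)
          qed
        qed
      qed
    next
      fix u assume u: "u < star_value ls"
      \<comment> \<open>Lengthening makes at most one empty leg nonempty, so \<open>ls\<close>
        retains at least two nonempty legs and its smaller values come from leg moves, which
        \<open>own\<close> and \<open>other\<close> transfer to the longer star.\<close>
      have "card (nonzero_legs ?ls) \<le> Suc (card (nonzero_legs ls))"
        unfolding nz by (simp add: card_insert_if)
      then have "2 \<le> card (nonzero_legs ls)" using False by simp
      then have "u \<in> leg_values ls" using u by (rule less_star_value_in_leg_values)
      then obtain j k where jk: "j < length ls" "k \<in> {1, 2, 4}" "k \<le> ls ! j"
        and u: "u = star_value (ls[j := ls ! j - k])" by (rule leg_valuesE)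
      show "u \<in> leg_values ?ls"
      proof (cases "j = i")
        case True
        then show ?thesis using leg_valuesI[of i ?ls k] own jk u i by simp
      next
        case False
        then show ?thesis using leg_valuesI[of j ?ls k] other[OF jk] jk u by simp
      qed
    qed
    finally show ?thesis .
  qed
qed

theorem theorem18:
  fixes m :: nat and ls :: "nat list"
  shows "grundy {1, 2, 4} (subdivided_star (ls @ [m + 3]))
       = grundy {1, 2, 4} (subdivided_star (ls @ [m]))"
  using star_value_add_three[of "length ls" "ls @ [m]"] by (simp add: star_value_def)

end
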